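(* Let $I$ and $J$ be proper nonzero monomial ideals of $R=\Bbbk[x_1,\ldots,x_n]$. The ideals $I$ and $J$ can be glued together if and only if there exists $m\in G(I)$ such that $I_m:(m)\subseteq J$. In this case the gluing is done with respect to $m$, and the gluing of $I$ and $J$ with respect to $m$ is $K=I_m+mJ$.
   Context: $\Bbbk$ is a field of characteristic zero and $R=\Bbbk[x_1,\ldots,x_n]$. For a monomial ideal $I$, $G(I)$ denotes its unique minimal set of monomial generators. For $m\in G(I)$, $I_m:=(G(I)\setminus\{m\})$ is the ideal generated by the remaining minimal generators (the zero ideal if there are none). For monomial ideals $I,J$ and a monomial $m$, a monomial ideal $K$ is called a gluing of $I$ and $J$ with respect to $m$ if $I=K+(m)$ and $J=K:(m)$. The ideals $I$ and $J$ can be glued together if there exist a monomial $m$ and a monomial ideal $K$ that is a gluing of $I$ and $J$ with respect to $m$, where $I$, $J$, $(m)$ and $K$ are all nontrivial, i.e. different from $0$ and $R$. Here $mJ=\{mg: g\in J\}$. *)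

theory Defs
  imports Complex_Main "HOL-Library.Poly_Mapping" "HOL-Library.Set_Algebras"
begin

text \<open>
  The polynomial ring in the finitely many variables indexed by \<open>'n\<close> is rendered as the monoid
  algebra of the exponent vectors \<open>'n \<Rightarrow>\<^sub>0 nat\<close>; the number of variables is \<open>CARD('n)\<close>.
\<close>

type_synonym ('n, 'k) mpoly = "('n \<Rightarrow>\<^sub>0 nat) \<Rightarrow>\<^sub>0 'k"

text \<open>Ideals of a commutative ring are the submodules of the ring over itself.\<close>

definition ideal :: "'a::comm_ring_1 set \<Rightarrow> 'a set"
  where "ideal B = module.span (*) B"

definition colon :: "'a::comm_ring_1 set \<Rightarrow> 'a set \<Rightarrow> 'a set"
  where "colon I J = {f. \<forall>g\<in>J. f * g \<in> I}"

definition nontrivial :: "'a::comm_ring_1 set \<Rightarrow> bool"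
  where "nontrivial I \<longleftrightarrow> I \<noteq> {0} \<and> I \<noteq> UNIV"

definition monomials :: "('n, 'k::field_char_0) mpoly set"
  where "monomials = range (\<lambda>t. Poly_Mapping.single t 1)"

definition monomial_ideal :: "('n, 'k::field_char_0) mpoly set \<Rightarrow> bool"
  where "monomial_ideal I \<longleftrightarrow> (\<exists>S\<subseteq>monomials. I = ideal S)"

definition is_min_gens :: "('n, 'k::field_char_0) mpoly set \<Rightarrow> ('n, 'k) mpoly set \<Rightarrow> bool"
  where "is_min_gens I G \<longleftrightarrow>
    G \<subseteq> monomials \<and> ideal G = I \<and> (\<forall>G'. G' \<subset> G \<longrightarrow> ideal G' \<noteq> I)"

text \<open>Well-defined for monomial ideals by \<open>ex1_is_min_gens\<close> below.\<close>

definition min_gens :: "('n, 'k::field_char_0) mpoly set \<Rightarrow> ('n, 'k) mpoly set"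
  where "min_gens I = (THE G. is_min_gens I G)"

definition remove_gen :: "('n, 'k::field_char_0) mpoly set \<Rightarrow> ('n, 'k) mpoly \<Rightarrow> ('n, 'k) mpoly set"
  where "remove_gen I m = ideal (min_gens I - {m})"

text \<open>Addition of sets is the elementwise one, hence the sum of ideals.\<close>

definition is_gluing ::
    "('n, 'k::field_char_0) mpoly set \<Rightarrow> ('n, 'k) mpoly set \<Rightarrow> ('n, 'k) mpoly \<Rightarrow> ('n, 'k) mpoly set \<Rightarrow> bool"
  where "is_gluing I J m K \<longleftrightarrow>
    monomial_ideal I \<and> monomial_ideal J \<and> m \<in> monomials \<and> monomial_ideal K \<and>
    I = K + ideal {m} \<and> J = colon K (ideal {m})"

definition can_be_glued :: "('n, 'k::field_char_0) mpoly set \<Rightarrow> ('n, 'k) mpoly set \<Rightarrow> bool"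
  where "can_be_glued I J \<longleftrightarrow>
    (\<exists>m K. is_gluing I J m K \<and>
      nontrivial I \<and> nontrivial J \<and> nontrivial (ideal {m}) \<and> nontrivial K)"

lemma module_times: "module ((*) :: 'a::comm_ring_1 \<Rightarrow> 'a \<Rightarrow> 'a)"
  by unfold_locales (auto simp: algebra_simps)

lemma keys_ideal_monomials:
  fixes S :: "('n, 'k::field_char_0) mpoly set"
  assumes "S \<subseteq> monomials" "p \<in> ideal S" "t \<in> Poly_Mapping.keys p"
  shows "\<exists>s u. Poly_Mapping.single s 1 \<in> S \<and> t = s + u"
proof -
  let ?A = "{p :: ('n, 'k) mpoly.
    \<forall>t\<in>Poly_Mapping.keys p. \<exists>s u. Poly_Mapping.single s 1 \<in> S \<and> t = s + u}"
  have "S \<subseteq> ?A"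
  proof
    fix p assume p: "p \<in> S"
    then obtain s where "p = Poly_Mapping.single s 1"
      using assms(1) by (auto simp: monomials_def)
    with p show "p \<in> ?A" by (auto intro: exI[of _ s] simp del: single_one)
  qed
  moreover have "module.subspace (*) ?A"
  proof (rule module.subspaceI[OF module_times])
    fix p q assume "p \<in> ?A" "q \<in> ?A"
    then show "p + q \<in> ?A" using Poly_Mapping.keys_add[of p q] by blast
  next
    fix c p assume p: "p \<in> ?A"
    show "c * p \<in> ?A"
    proof (clarify)
      fix t assume "t \<in> Poly_Mapping.keys (c * p)"
      then obtain a b where "t = a + b" "b \<in> Poly_Mapping.keys p"
        using keys_mult[of c p] by blast
      moreover from this p obtain s u where "Poly_Mapping.single s 1 \<in> S" "b = s + u" by blast
      ultimately show "\<exists>s u. Poly_Mapping.single s 1 \<in> S \<and> t = s + u"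
        by (metis add.left_commute)
    qed
  qed simp
  ultimately have "ideal S \<subseteq> ?A"
    unfolding ideal_def by (rule module.span_minimal[OF module_times])
  then show ?thesis using assms(2,3) by blast
qed

lemma ex1_is_min_gens:
  fixes I :: "('n::finite, 'k::field_char_0) mpoly set"
  assumes "monomial_ideal I"
  shows "\<exists>!G. is_min_gens I G"
proof -
  let ?m = "\<lambda>t. Poly_Mapping.single t 1 :: ('n, 'k) mpoly"
  define G where "G = ?m ` {t. ?m t \<in> I \<and> (\<forall>s u. ?m s \<in> I \<longrightarrow> t = s + u \<longrightarrow> u = 0)}"
  obtain S where S: "S \<subseteq> monomials" "I = ideal S"
    using assms by (auto simp: monomial_ideal_def)
  have G: "G \<subseteq> monomials" "G \<subseteq> I" by (auto simp: G_def monomials_def)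
  have in_G: "?m t \<in> ideal G" if "?m t \<in> I" for t
    using that
  proof (induction "\<Sum>x\<in>UNIV. Poly_Mapping.lookup t x" arbitrary: t rule: less_induct)
    case less
    show ?case
    proof (cases "\<forall>s u. ?m s \<in> I \<longrightarrow> t = s + u \<longrightarrow> u = 0")
      case True
      then show ?thesis using less.prems
        unfolding ideal_def by (intro module.span_base[OF module_times]) (auto simp: G_def)
    next
      case False
      then obtain s u where su: "?m s \<in> I" "t = s + u" "u \<noteq> 0" by blast
      then obtain x where "Poly_Mapping.lookup u x \<noteq> 0"
        by (metis poly_mapping_eqI lookup_zero)
      then have "(\<Sum>x\<in>UNIV. Poly_Mapping.lookup s x) < (\<Sum>x\<in>UNIV. Poly_Mapping.lookup t x)"
        by (intro sum_strict_mono_ex1) (auto simp: su(2) lookup_add intro!: exI[of _ x])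
      then have "?m s \<in> ideal G" using less.hyps su(1) by blast
      then have "?m u * ?m s \<in> ideal G"
        unfolding ideal_def by (rule module.span_scale[OF module_times])
      then show ?thesis by (simp add: mult_single su(2) add.commute)
    qed
  qed
  have "S \<subseteq> I"
    unfolding S(2) ideal_def by (rule module.span_superset[OF module_times])
  then have "S \<subseteq> ideal G" using in_G S(1) by (force simp: monomials_def)
  then have "I \<subseteq> ideal G"
    unfolding S(2) ideal_def
    by (rule module.span_minimal[OF module_times _ module.subspace_span[OF module_times]])
  moreover have "ideal G \<subseteq> I"
    using G(2) unfolding S(2) ideal_def
    by (rule module.span_minimal[OF module_times _ module.subspace_span[OF module_times]])
  ultimately have gen: "ideal G = I" by blast
  have least: "G \<subseteq> H" if H: "H \<subseteq> monomials" "ideal H = I" for H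
  proof
    fix p assume "p \<in> G"
    then obtain t where t: "p = ?m t" "?m t \<in> I" "\<And>s u. ?m s \<in> I \<Longrightarrow> t = s + u \<Longrightarrow> u = 0"
      by (auto simp: G_def)
    then obtain s u where su: "?m s \<in> H" "t = s + u"
      using keys_ideal_monomials[OF H(1), of "?m t" t] H(2) by auto
    have "H \<subseteq> I"
      unfolding H(2)[symmetric] ideal_def by (rule module.span_superset[OF module_times])
    then have "u = 0" using t(3) su by blast
    then show "p \<in> H" using su t(1) by simp
  qed
  have "is_min_gens I G"
    unfolding is_min_gens_def using G(1) gen least by blast
  moreover have "H = G" if "is_min_gens I H" for H
    using that least[of H] gen unfolding is_min_gens_def by blast
  ultimately show ?thesis by blast
qed

end

theory Submission
  imports Defs
begin

text \<open>
  The minimal generating set \<open>G(I)\<close> is contained in every monomial generating set of \<open>I\<close>. If \<open>K\<close> is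
  generated by the monomials \<open>S\<close> and \<open>I = K + (m)\<close>, this gives \<open>G(I) \<subseteq> S \<union> {m}\<close> and hence \<open>I\<^sub>m \<subseteq> K\<close>.
  Since \<open>J = K : (m)\<close> is proper, \<open>m \<notin> K\<close>, so that \<open>m \<in> G(I)\<close>. The remaining claims follow by
  decomposing elements along \<open>I = I\<^sub>m + (m)\<close>, without looking at monomials any more.
\<close>

text \<open>The rewrite clause makes the library facts on spans available as facts on
  \<open>ideal\<close>.\<close>

interpretation ideal: module "(*) :: 'a::comm_ring_1 \<Rightarrow> 'a \<Rightarrow> 'a"
  rewrites "module.span (*) = (ideal :: 'a set \<Rightarrow> 'a set)"
  by (rule module_times) (simp add: ideal_def fun_eq_iff)

declare ideal.scale_scale [simp del] \<comment> \<open>associativity, oriented against \<open>mult.assoc\<close>\<close>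

section \<open>Sums, multiples and colons of ideals\<close>

lemma ideal_Un: "ideal (A \<union> B) = ideal A + ideal B"
  by (auto simp: ideal.span_Un set_plus_def)

lemma ideal_singleton: "ideal {m} = range ((*) m)"
  by (auto simp: ideal.span_singleton mult.commute)

text \<open>Multiplication by \<open>m\<close> is linear, so it carries spans to spans. This
  provides generators for \<open>mJ\<close>.\<close>

lemma ideal_times_image: "ideal ((*) m ` S) = (*) m ` ideal S"
proof
  have "module.subspace (*) ((*) m ` ideal S)"
  proof (rule ideal.subspaceI)
    show "0 \<in> (*) m ` ideal S"
      by (rule image_eqI[of _ _ 0]) (auto simp: ideal.span_zero)
  next
    fix x y assume "x \<in> (*) m ` ideal S" "y \<in> (*) m ` ideal S"
    then show "x + y \<in> (*) m ` ideal S"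
      by (auto simp: ideal.span_add simp flip: distrib_left)
  next
    fix c x assume "x \<in> (*) m ` ideal S"
    then obtain y where y: "x = m * y" "y \<in> ideal S" by blast
    then have "c * x = m * (c * y)" by (simp add: mult.left_commute)
    then show "c * x \<in> (*) m ` ideal S" using ideal.span_scale[OF y(2)] by blast
  qed
  moreover have "(*) m ` S \<subseteq> (*) m ` ideal S"
    using ideal.span_superset by blast
  ultimately show "ideal ((*) m ` S) \<subseteq> (*) m ` ideal S"
    by (intro ideal.span_minimal)
  show "(*) m ` ideal S \<subseteq> ideal ((*) m ` S)"
  proof clarify
    fix x assume "x \<in> ideal S"
    then show "m * x \<in> ideal ((*) m ` S)"
    proof (induction rule: ideal.span_induct_alt)
      case base
      show ?case by (simp add: ideal.span_zero)
    next
      case (step c x y)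
      then have "m * x \<in> ideal ((*) m ` S)" by (intro ideal.span_base imageI)
      then have "c * (m * x) + m * y \<in> ideal ((*) m ` S)"
        using ideal.span_add[OF ideal.span_scale] step by blast
      then show ?case by (simp add: algebra_simps)
    qed
  qed
qed

text \<open>All elements of \<open>ideal {m}\<close> are multiples of \<open>m\<close>, and
  \<open>ideal A\<close> absorbs multiples, so testing the generator suffices.\<close>

lemma colon_ideal_singleton: "f \<in> colon (ideal A) (ideal {m}) \<longleftrightarrow> f * m \<in> ideal A"
proof
  assume "f * m \<in> ideal A"
  then have "c * (f * m) \<in> ideal A" for c by (rule ideal.span_scale)
  then show "f \<in> colon (ideal A) (ideal {m})"
    by (auto simp: colon_def ideal_singleton ac_simps)
qed (auto simp: colon_def intro: ideal.span_base)

section \<open>Monomials and minimal generating sets\<close>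

lemma monomials_nonzero: "m \<in> monomials \<Longrightarrow> m \<noteq> 0"
  by (auto simp: monomials_def dest: arg_cong[where f = Poly_Mapping.keys])

lemma monomials_mult: "m \<in> monomials \<Longrightarrow> m' \<in> monomials \<Longrightarrow> m * m' \<in> monomials"
  by (auto simp: monomials_def mult_single)

lemma is_min_gens_min_gens:
  fixes I :: "('n::finite, 'k::field_char_0) mpoly set"
  assumes "monomial_ideal I"
  shows "is_min_gens I (min_gens I)"
  unfolding min_gens_def by (rule theI'[OF ex1_is_min_gens[OF assms]])

lemma monomial_in_ideal_dvd:
  fixes S :: "('n, 'k::field_char_0) mpoly set"
  assumes "S \<subseteq> monomials" "Poly_Mapping.single t 1 \<in> ideal S"
  obtains s u where "Poly_Mapping.single s 1 \<in> S" "t = s + u"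
  using keys_ideal_monomials[OF assms, of t] by auto

text \<open>Each \<open>g\<close> in \<open>G\<close> is divisible by a monomial of
  \<open>H\<close>, which in turn is divisible by some \<open>r\<close> in \<open>G\<close>.
  Minimality forces that last monomial to be \<open>g\<close>, so both quotients are 1 and
  \<open>g\<close> is in \<open>H\<close>.\<close>

lemma is_min_gens_subset:
  fixes I :: "('n, 'k::field_char_0) mpoly set"
  assumes G: "is_min_gens I G" and H: "H \<subseteq> monomials" "ideal H = I"
  shows "G \<subseteq> H"
proof
  let ?m = "\<lambda>t. Poly_Mapping.single t 1 :: ('n, 'k) mpoly"
  have GM: "G \<subseteq> monomials" "ideal G = I" using G by (auto simp: is_min_gens_def)
  fix g assume g: "g \<in> G"
  then obtain t where t: "g = ?m t" using GM by (auto simp: monomials_def)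
  have "?m t \<in> ideal H" using g t GM H ideal.span_base by blast
  then obtain s u where su: "?m s \<in> H" "t = s + u" using monomial_in_ideal_dvd H(1) by blast
  then have "?m s \<in> ideal G" using GM H ideal.span_base by blast
  then obtain r v where rv: "?m r \<in> G" "s = r + v" using monomial_in_ideal_dvd GM(1) by blast
  have "?m r = g"
  proof (rule ccontr)
    assume "?m r \<noteq> g"
    \<comment> \<open>The product is \<open>g\<close> itself, since \<open>t = r + v + u\<close>; so
      \<open>g\<close> would be redundant in \<open>G\<close>.\<close>
    then have "?m (u + v) * ?m r \<in> ideal (G - {g})"
      using rv by (intro ideal.span_scale ideal.span_base) auto
    then have "g \<in> ideal (G - {g})" by (simp add: mult_single t su rv ac_simps)
    then have "G \<subseteq> ideal (G - {g})" using ideal.span_superset[of "G - {g}"] by blast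
    then have "ideal (G - {g}) = I"
      unfolding GM(2)[symmetric] ideal.span_eq using ideal.span_superset[of G] by blast
    then show False using G g unfolding is_min_gens_def by blast
  qed
  then have "r = t" by (auto simp: t dest: arg_cong[where f = Poly_Mapping.keys])
  then have "v + u = 0" using su rv by (simp add: add.assoc)
  \<comment> \<open>Exponents are natural numbers, so a vanishing sum has vanishing
    summands.\<close>
  then have "u = 0" by (auto simp: poly_mapping_eq_iff fun_eq_iff lookup_add)
  then show "g \<in> H" using su t by simp
qed

lemma monomial_ideal_add_times_image:
  fixes J :: "('n, 'k::field_char_0) mpoly set"
  assumes "G \<subseteq> monomials" "m \<in> monomials" "monomial_ideal J"
  shows "monomial_ideal (ideal G + (*) m ` J)"
proof -
  obtain S where S: "S \<subseteq> monomials" "J = ideal S"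
    using assms(3) by (auto simp: monomial_ideal_def)
  then have "G \<union> (*) m ` S \<subseteq> monomials" using assms monomials_mult by blast
  moreover have "ideal G + (*) m ` J = ideal (G \<union> (*) m ` S)"
    by (simp add: S ideal_Un ideal_times_image)
  ultimately show ?thesis unfolding monomial_ideal_def by blast
qed

section \<open>Gluings: necessary condition, uniqueness, existence\<close>

lemma gluing_min_gens:
  fixes I J :: "('n::finite, 'k::field_char_0) mpoly set"
  assumes glue: "is_gluing I J m K" and J: "nontrivial J"
  shows "m \<in> min_gens I" "remove_gen I m \<subseteq> K" "colon (remove_gen I m) (ideal {m}) \<subseteq> J"
proof -
  have m: "m \<in> monomials" and I: "I = K + ideal {m}" and JK: "J = colon K (ideal {m})"
    and G: "is_min_gens I (min_gens I)"
    using glue by (auto simp: is_gluing_def intro: is_min_gens_min_gens)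
  obtain S where S: "S \<subseteq> monomials" "K = ideal S"
    using glue by (auto simp: is_gluing_def monomial_ideal_def)
  have sub: "min_gens I \<subseteq> S \<union> {m}"
    using m S by (intro is_min_gens_subset[OF G]) (simp_all only: I ideal_Un, simp)
  then show "remove_gen I m \<subseteq> K"
    unfolding S remove_gen_def by (intro ideal.span_mono) blast
  then show "colon (remove_gen I m) (ideal {m}) \<subseteq> J"
    unfolding JK colon_def by blast
  show "m \<in> min_gens I"
  proof (rule ccontr)
    \<comment> \<open>Then \<open>S\<close> contains all minimal generators, so
      \<open>m \<in> I \<subseteq> K\<close>. This puts 1 into the colon ideal \<open>J\<close>,
      which is proper.\<close>
    assume "m \<notin> min_gens I"
    then have "ideal (min_gens I) \<subseteq> K"
      using sub unfolding S by (intro ideal.span_mono) blast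
    then have "I \<subseteq> K" using G by (simp add: is_min_gens_def)
    moreover have "m \<in> I"
      using m S(2) ideal.span_zero[of S] ideal.span_base[of m "{m}"] set_plus_intro[of 0 K m "ideal {m}"]
      by (simp add: I)
    ultimately have one: "1 \<in> J"
      using colon_ideal_singleton[of 1 S m] JK S(2) by auto
    have "x \<in> J" for x
      using one colon_ideal_singleton[of 1 S m] colon_ideal_singleton[of x S m]
        ideal.span_scale[of m S x] JK S(2) by simp
    then show False using J by (auto simp: nontrivial_def)
  qed
qed

lemma ideal_min_gens_decomp:
  fixes I :: "('n::finite, 'k::field_char_0) mpoly set"
  assumes "monomial_ideal I" "m \<in> min_gens I"
  shows "I = remove_gen I m + ideal {m}"
proof -
  have "I = ideal (min_gens I)"
    using is_min_gens_min_gens[OF assms(1)] by (simp add: is_min_gens_def)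
  also have "min_gens I = (min_gens I - {m}) \<union> {m}" using assms(2) by blast
  finally show ?thesis by (simp only: ideal_Un remove_gen_def)
qed

text \<open>If \<open>f * m = a + m * j\<close>, then \<open>(f - j) * m = a\<close>, so
  \<open>f - j\<close> lies in the smaller colon ideal and hence in \<open>ideal S\<close>. No
  cancellation of \<open>m\<close> is involved.\<close>

lemma colon_add_times_image:
  assumes "colon (ideal G) (ideal {m}) \<subseteq> ideal S"
  shows "colon (ideal G + (*) m ` ideal S) (ideal {m}) = ideal S"
proof -
  have "f * m \<in> ideal G + (*) m ` ideal S \<longleftrightarrow> f \<in> ideal S" for f
  proof
    assume "f * m \<in> ideal G + (*) m ` ideal S"
    then obtain a j where aj: "a \<in> ideal G" "j \<in> ideal S" "f * m = a + m * j"
      by (auto simp: set_plus_def)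
    then have "(f - j) * m = a" by (simp add: algebra_simps)
    then have "f - j \<in> ideal S" using assms aj(1) colon_ideal_singleton by blast
    then show "f \<in> ideal S" using ideal.span_add[OF _ aj(2)] by fastforce
  next
    assume "f \<in> ideal S"
    then have "0 + m * f \<in> ideal G + (*) m ` ideal S"
      by (intro set_plus_intro imageI ideal.span_zero)
    then show "f * m \<in> ideal G + (*) m ` ideal S" by (simp add: mult.commute)
  qed
  \<comment> \<open>The sum has to appear as a single \<open>ideal\<close> for
    \<open>colon_ideal_singleton\<close> to apply.\<close>
  moreover have "ideal G + (*) m ` ideal S = ideal (G \<union> (*) m ` S)"
    by (simp add: ideal_Un ideal_times_image)
  ultimately show ?thesis by (auto simp: colon_ideal_singleton)
qed

text \<open>An element \<open>k\<close> of \<open>K\<close> lies in \<open>I\<close>, so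
  \<open>k = a + m * f\<close> with \<open>a\<close> in \<open>remove_gen I m\<close>. As that ideal
  is inside \<open>K\<close>, so is \<open>m * f\<close>, which means
  \<open>f \<in> K : (m) = J\<close>.\<close>

lemma gluing_unique:
  fixes I J :: "('n::finite, 'k::field_char_0) mpoly set"
  assumes glue: "is_gluing I J m K" and J: "nontrivial J"
  shows "K = remove_gen I m + (*) m ` J"
proof -
  note m = gluing_min_gens[OF assms]
  obtain S where S: "K = ideal S"
    using glue by (auto simp: is_gluing_def monomial_ideal_def)
  have mJ: "f * m \<in> K \<longleftrightarrow> f \<in> J" for f
    using glue by (simp add: is_gluing_def S colon_ideal_singleton)
  show ?thesis
  proof (intro equalityI subsetI)
    fix k assume k: "k \<in> K"
    then have "k + 0 \<in> I"
      using glue ideal.span_zero[of "{m}"] unfolding is_gluing_def by blast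
    moreover have "monomial_ideal I" using glue unfolding is_gluing_def by blast
    ultimately have "k \<in> remove_gen I m + ideal {m}"
      using ideal_min_gens_decomp[OF _ m(1)] by auto
    then obtain a f where af: "a \<in> remove_gen I m" "k = a + m * f"
      by (auto simp: set_plus_def ideal_singleton)
    then have "k - a \<in> K" using k m(2) ideal.span_diff S by blast
    then have "f \<in> J" using mJ[of f] af by (simp add: mult.commute)
    then show "k \<in> remove_gen I m + (*) m ` J" using af by blast
  next
    fix k assume "k \<in> remove_gen I m + (*) m ` J"
    then obtain a f where "a \<in> remove_gen I m" "f \<in> J" "k = a + f * m"
      by (auto simp: set_plus_def mult.commute)
    then show "k \<in> K" using m(2) mJ ideal.span_add S by blast
  qed
qed

text \<open>Adding \<open>(m)\<close> to \<open>K\<close> absorbs \<open>mJ\<close> and leaves the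
  decomposition of \<open>I\<close>; the colon is computed by \<open>colon_add_times_image\<close>.
  Properness of \<open>K\<close> and \<open>(m)\<close> is inherited from \<open>I\<close>.\<close>

lemma gluing_exists:
  fixes I J :: "('n::finite, 'k::field_char_0) mpoly set"
  assumes I: "monomial_ideal I" "nontrivial I"
    and J: "monomial_ideal J" "nontrivial J"
    and m: "m \<in> min_gens I" "colon (remove_gen I m) (ideal {m}) \<subseteq> J"
  defines "K \<equiv> remove_gen I m + (*) m ` J"
  shows "is_gluing I J m K" and "nontrivial (ideal {m})" "nontrivial K"
proof -
  have G: "is_min_gens I (min_gens I)" using I by (intro is_min_gens_min_gens)
  then have GM: "min_gens I \<subseteq> monomials" and mM: "m \<in> monomials"
    using m(1) by (auto simp: is_min_gens_def)
  obtain S where S: "S \<subseteq> monomials" "J = ideal S"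
    using J(1) by (auto simp: monomial_ideal_def)
  have IG: "I = ideal (min_gens I)" using G by (simp add: is_min_gens_def)
  have KS: "K = ideal ((min_gens I - {m}) \<union> (*) m ` S)"
    by (simp add: K_def S remove_gen_def ideal_Un ideal_times_image)
  have "(*) m ` S \<union> {m} \<subseteq> ideal {m}" "{m} \<subseteq> ideal ((*) m ` S \<union> {m})"
    using ideal.span_superset[of "(*) m ` S \<union> {m}"]
    by (auto simp: ideal_singleton intro: range_eqI[of _ _ 1])
  then have "ideal ((*) m ` S \<union> {m}) = ideal {m}" by (simp only: ideal.span_eq)
  then have absorb: "(*) m ` ideal S + ideal {m} = ideal {m}"
    by (simp only: ideal_Un ideal_times_image)
  have KI: "K + ideal {m} = I"
    using ideal_min_gens_decomp[OF I(1) m(1)] absorb by (simp add: K_def S add.assoc)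
  have "monomial_ideal K"
    unfolding K_def remove_gen_def using GM mM J
    by (intro monomial_ideal_add_times_image) auto
  moreover have "colon K (ideal {m}) = J"
    using m(2) unfolding K_def S remove_gen_def by (rule colon_add_times_image)
  ultimately show "is_gluing I J m K"
    using I J mM KI by (simp add: is_gluing_def)
  have sub: "ideal {m} \<subseteq> I"
    using m(1) by (subst IG) (rule ideal.span_mono, blast)
  have "m \<in> ideal {m}" by (auto intro: ideal.span_base)
  then show "nontrivial (ideal {m})"
    using sub I(2) monomials_nonzero[OF mM] by (auto simp: nontrivial_def)
  \<comment> \<open>The empty set spans only 0, so \<open>S\<close> is nonempty;
    \<open>m * s\<close> will be a nonzero element of \<open>K\<close>.\<close>
  obtain s where s: "s \<in> S"
    using J(2) unfolding S nontrivial_def by fastforce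
  then have "m * s \<in> K" unfolding KS by (intro ideal.span_base) auto
  moreover have "m * s \<noteq> 0"
    using s S mM by (intro monomials_nonzero monomials_mult) auto
  moreover have "K \<subseteq> I"
    \<comment> \<open>The library fact adds the set containing 0 on the left, hence the commuted
      sum.\<close>
    using set_zero_plus2[OF ideal.span_zero] unfolding KI[symmetric] add.commute[of K] .
  ultimately show "nontrivial K" using I(2) by (auto simp: nontrivial_def)
qed

text \<open>The English "in this case" is split in two: the second conjunct restricts the monomials
  that can occur in a gluing, and the third gives existence, uniqueness and nontriviality for each
  monomial meeting the criterion.\<close>

theorem theorem7:
  fixes I J :: "('n::finite, 'k::field_char_0) mpoly set"
  assumes "monomial_ideal I" and "nontrivial I"
    and "monomial_ideal J" and "nontrivial J"
  shows "(can_be_glued I J \<longleftrightarrow>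
            (\<exists>m\<in>min_gens I. colon (remove_gen I m) (ideal {m}) \<subseteq> J)) \<and>
         (\<forall>m K. is_gluing I J m K \<longrightarrow>
            m \<in> min_gens I \<and> colon (remove_gen I m) (ideal {m}) \<subseteq> J) \<and>
         (\<forall>m\<in>min_gens I. colon (remove_gen I m) (ideal {m}) \<subseteq> J \<longrightarrow>
            nontrivial (ideal {m}) \<and> nontrivial (remove_gen I m + (*) m ` J) \<and>
            (\<forall>K. is_gluing I J m K \<longleftrightarrow> K = remove_gen I m + (*) m ` J))"
proof (intro conjI allI impI ballI)
  fix m K assume "is_gluing I J m K"
  from gluing_min_gens[OF this assms(4)]
  show "m \<in> min_gens I" "colon (remove_gen I m) (ideal {m}) \<subseteq> J" by blast+
next
  fix m assume m: "m \<in> min_gens I" "colon (remove_gen I m) (ideal {m}) \<subseteq> J"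
  note ex = gluing_exists[OF assms m]
  show "nontrivial (ideal {m})" "nontrivial (remove_gen I m + (*) m ` J)"
    by (fact ex)+
  show "is_gluing I J m K \<longleftrightarrow> K = remove_gen I m + (*) m ` J" for K
    using ex(1) gluing_unique[OF _ assms(4)] by blast
next
  show "can_be_glued I J \<longleftrightarrow> (\<exists>m\<in>min_gens I. colon (remove_gen I m) (ideal {m}) \<subseteq> J)"
  proof
    assume "can_be_glued I J"
    then obtain m K where "is_gluing I J m K" by (auto simp: can_be_glued_def)
    from gluing_min_gens[OF this assms(4)]
    show "\<exists>m\<in>min_gens I. colon (remove_gen I m) (ideal {m}) \<subseteq> J" by blast
  next
    assume "\<exists>m\<in>min_gens I. colon (remove_gen I m) (ideal {m}) \<subseteq> J"
    then show "can_be_glued I J"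
      using gluing_exists[OF assms] assms unfolding can_be_glued_def by blast
  qed
qed

end
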